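(* Let $m\geq 3$ and let $\tau=(0\;3)(1\;2)$, a permutation of $\mathbb{Z}_4$. The graph $C_m\Box_\tau C_4$ is both $2$-spanning cyclable and $3$-spanning cyclable.
   Context: For a permutation $\tau$ of $\mathbb{Z}_n$, the graph $C_m\Box_\tau C_n$ is obtained from the Cartesian product $P_m\Box C_n$, with vertices $u_{i,j}$ ($0\le i\le m-1$, $j\in\mathbb{Z}_n$) and edges $[u_{i,j},u_{i,j+1}]$ for all $i,j$ and $[u_{i,j},u_{i+1,j}]$ for $0\le i\le m-2$, by adding the edges $[u_{m-1,j},u_{0,\tau(j)}]$ for all $j$. A 2-factor of a graph is a spanning subgraph in which every vertex has valency 2; it separates a set $A$ of $k$ vertices if it consists of exactly $k$ cycles and $A$ meets the vertex set of each cycle in exactly one vertex. A graph $X$ is $k$-spanning cyclable if for every $A\subseteq V(X)$ with $|A|=k$ there is a 2-factor of $X$ separating $A$. *)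

theory Defs
  imports "HOL-Combinatorics.Permutations"
begin

(* Undirected graphs without multiple edges; an edge is the set of its two end vertices. *)
record 'a ugraph =
  verts :: "'a set"
  edges :: "'a set set"

definition simple_graph :: "'a ugraph \<Rightarrow> bool" where
  "simple_graph G \<longleftrightarrow> (\<forall>e \<in> edges G. e \<subseteq> verts G \<and> card e = 2)"

definition valency :: "'a ugraph \<Rightarrow> 'a \<Rightarrow> nat" where
  "valency G v = card {e \<in> edges G. v \<in> e}"

definition spanning_subgraph :: "'a ugraph \<Rightarrow> 'a ugraph \<Rightarrow> bool" where
  "spanning_subgraph F G \<longleftrightarrow> simple_graph F \<and> verts F = verts G \<and> edges F \<subseteq> edges G"

definition two_factor :: "'a ugraph \<Rightarrow> 'a ugraph \<Rightarrow> bool" where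
  "two_factor F G \<longleftrightarrow> spanning_subgraph F G \<and> (\<forall>v \<in> verts F. valency F v = 2)"

definition cycle_graph :: "'a list \<Rightarrow> 'a ugraph" where
  "cycle_graph vs =
     \<lparr>verts = set vs, edges = {{vs ! i, vs ! (Suc i mod length vs)} |i. i < length vs}\<rparr>"

definition is_cycle_graph :: "'a ugraph \<Rightarrow> bool" where
  "is_cycle_graph C \<longleftrightarrow> (\<exists>vs. distinct vs \<and> 3 \<le> length vs \<and> C = cycle_graph vs)"

(* F is the disjoint union of the set Cs of cycles. *)
definition consists_of_cycles :: "'a ugraph \<Rightarrow> 'a ugraph set \<Rightarrow> bool" where
  "consists_of_cycles F Cs \<longleftrightarrow>
     (\<forall>C \<in> Cs. is_cycle_graph C) \<and>
     (\<forall>C \<in> Cs. \<forall>D \<in> Cs. C \<noteq> D \<longrightarrow> verts C \<inter> verts D = {}) \<and>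
     verts F = (\<Union>C \<in> Cs. verts C) \<and>
     edges F = (\<Union>C \<in> Cs. edges C)"

definition separates :: "'a ugraph \<Rightarrow> 'a set \<Rightarrow> bool" where
  "separates F A \<longleftrightarrow>
     (\<exists>Cs. finite Cs \<and> card Cs = card A \<and> consists_of_cycles F Cs \<and>
           (\<forall>C \<in> Cs. card (A \<inter> verts C) = 1))"

definition spanning_cyclable :: "nat \<Rightarrow> 'a ugraph \<Rightarrow> bool" where
  "spanning_cyclable k X \<longleftrightarrow>
     (\<forall>A. A \<subseteq> verts X \<and> finite A \<and> card A = k \<longrightarrow> (\<exists>F. two_factor F X \<and> separates F A))"

(* The pair (i, j) is the vertex u_{i,j}; the elements of Z_n are represented by 0, ..., n - 1. *)
definition path_box_cycle :: "nat \<Rightarrow> nat \<Rightarrow> (nat \<times> nat) ugraph" where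
  "path_box_cycle m n =
     \<lparr>verts = {0..<m} \<times> {0..<n},
      edges = {{(i, j), (i, Suc j mod n)} |i j. i < m \<and> j < n} \<union>
              {{(i, j), (Suc i, j)} |i j. Suc i < m \<and> j < n}\<rparr>"

(* Intended for m, n \<ge> 3 and tau a permutation of {0..<n}, as these guarantee a simple graph. *)
definition twisted_box :: "nat \<Rightarrow> (nat \<Rightarrow> nat) \<Rightarrow> nat \<Rightarrow> (nat \<times> nat) ugraph" where
  "twisted_box m \<tau> n =
     \<lparr>verts = verts (path_box_cycle m n),
      edges = edges (path_box_cycle m n) \<union> {{(m - 1, j), (0, \<tau> j)} |j. j < n}\<rparr>"

lemma simple_graph_twisted_box:
  assumes "3 \<le> m" "3 \<le> n" "\<tau> permutes {0..<n}"
  shows "simple_graph (twisted_box m \<tau> n)"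
proof -
  have "\<tau> j < n" if "j < n" for j
    using permutes_in_image[OF assms(3), of j] that by simp
  moreover have "j \<noteq> Suc j mod n" if "j < n" for j
    using that assms(2) by (cases "Suc j = n") auto
  ultimately show ?thesis
    using assms(1,2) unfolding simple_graph_def twisted_box_def path_box_cycle_def
    by (auto simp: card_insert_if)
qed

definition tau_refl :: "nat \<Rightarrow> nat" where
  "tau_refl = transpose 0 3 \<circ> transpose 1 2"

lemma tau_refl_permutes: "tau_refl permutes {0..<4}"
  unfolding tau_refl_def
  by (intro permutes_compose permutes_swap_id) auto

end

(* Write X_m for the graph. Moving every row one step up, with the twist applied on wrapping
   around, is an automorphism, and X_m is vertex-transitive. If two cyclically consecutive rows
   miss A and m >= 5, rotate them to the end and delete them: a 2-factor of X_(m-2) separating A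
   extends to X_m. If it uses the twisted edges exactly in a nonempty set S of columns, then each of
   these edges is replaced by a detour that runs up one arc of the columns cut off by S in the first
   new row and back in the second one; if S is empty, then a horizontal edge of the last old row is
   rerouted through all eight new vertices. If no two consecutive rows miss A, then m <= 2 |A|, and
   there remain m = 3, 4, and m = 5, 6 for |A| = 3, where explicit 2-factors suffice for all A
   containing u_(0,0). *)
theory Submission
  imports Defs
begin

section \<open>Cycles as closed walks\<close>

fun path_edges :: "'a list \<Rightarrow> 'a set set" where
  "path_edges (x # y # zs) = insert {x, y} (path_edges (y # zs))"
| "path_edges _ = {}"

lemma path_edges_conv_nth: "path_edges xs = {{xs ! i, xs ! Suc i} |i. Suc i < length xs}"
proof (induction xs rule: path_edges.induct)
  case (1 x y zs)
  have "{{(x # y # zs) ! i, (x # y # zs) ! Suc i} |i. Suc i < length (x # y # zs)}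
      = insert {x, y} {{(y # zs) ! i, (y # zs) ! Suc i} |i. Suc i < length (y # zs)}"
    (is "?L = ?R")
  proof
    show "?L \<subseteq> ?R"
    proof
      fix e assume "e \<in> ?L"
      then obtain i where "e = {(x # y # zs) ! i, (x # y # zs) ! Suc i}"
        "Suc i < length (x # y # zs)" by blast
      then show "e \<in> ?R" by (cases i) auto
    qed
    show "?R \<subseteq> ?L"
    proof
      fix e assume "e \<in> ?R"
      then consider "e = {x, y}"
        | i where "e = {(y # zs) ! i, (y # zs) ! Suc i}" "Suc i < length (y # zs)" by blast
      then show "e \<in> ?L"
      proof cases
        case 1
        then show ?thesis by (intro CollectI exI[of _ 0]) auto
      next
        case (2 i)
        then show ?thesis by (intro CollectI exI[of _ "Suc i"]) auto
      qed
    qed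
  qed
  with 1 show ?case by simp
qed auto

lemma path_edges_append:
  "path_edges (xs @ y # ys) = path_edges (xs @ [y]) \<union> path_edges (y # ys)"
  by (induction xs rule: path_edges.induct) auto

lemma path_edges_rev: "path_edges (rev xs) = path_edges xs"
proof (induction xs rule: path_edges.induct)
  case (1 x y zs)
  have "path_edges (rev (x # y # zs)) = path_edges (rev zs @ [y]) \<union> path_edges [y, x]"
    using path_edges_append[of "rev zs" y "[x]"] by simp
  with 1 show ?case by (auto simp: insert_commute)
qed auto

lemma path_edges_map: "path_edges (map f xs) = (`) f ` path_edges xs"
  by (induction xs rule: path_edges.induct) auto

lemma path_edges_subset: "e \<in> path_edges xs \<Longrightarrow> e \<subseteq> set xs"
  by (induction xs rule: path_edges.induct) auto

lemma path_edges_cases: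
  assumes "e \<in> path_edges xs"
  obtains ys zs x y where "xs = ys @ x # y # zs" "e = {x, y}"
proof -
  have "\<exists>ys zs x y. xs = ys @ x # y # zs \<and> e = {x, y}"
    using assms
  proof (induction xs rule: path_edges.induct)
    case (1 x y zs)
    show ?case
    proof (cases "e = {x, y}")
      case True
      then show ?thesis by (metis append_Nil)
    next
      case False
      with 1 obtain ys' zs' x' y' where "y # zs = ys' @ x' # y' # zs'" "e = {x', y'}" by auto
      then show ?thesis by (metis append_Cons)
    qed
  qed auto
  with that show ?thesis by blast
qed

lemma verts_cycle_graph [simp]: "verts (cycle_graph vs) = set vs"
  by (simp add: cycle_graph_def)

text \<open>Repeating the first vertex at the end trades indices modulo the length for a walk, so
  that cutting, rotating and reversing cycles become list operations.\<close>

lemma edges_cycle_graph: "edges (cycle_graph (v # vs)) = path_edges (v # vs @ [v])"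
proof -
  have "(v # vs @ [v]) ! Suc i = (v # vs) ! (Suc i mod length (v # vs))"
    "(v # vs @ [v]) ! i = (v # vs) ! i" if "i < length (v # vs)" for i
    using that by (cases "i = length vs"; auto simp: nth_append nth_Cons')+
  then have "{(v # vs @ [v]) ! i, (v # vs @ [v]) ! Suc i} =
      {(v # vs) ! i, (v # vs) ! (Suc i mod length (v # vs))}" if "i < length (v # vs)" for i
    using that by simp
  then show ?thesis
    unfolding path_edges_conv_nth cycle_graph_def by (auto simp del: nth_Cons_Suc)
qed

text \<open>Cut at the heads of \<open>xs\<close> and \<open>ys\<close>, both closed walks fall into
  the same two paths, in opposite order.\<close>

lemma cycle_graph_rotate: "cycle_graph (xs @ ys) = cycle_graph (ys @ xs)"
proof (cases "xs = [] \<or> ys = []")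
  case False
  then obtain x xs' y ys' where eq: "xs = x # xs'" "ys = y # ys'"
    by (auto simp: neq_Nil_conv)
  have "edges (cycle_graph (xs @ ys)) = edges (cycle_graph (ys @ xs))"
    using path_edges_append[of "x # xs'" y "ys' @ [x]"] path_edges_append[of "y # ys'" x "xs' @ [y]"]
    by (auto simp: eq edges_cycle_graph)
  then show ?thesis
    by (intro ugraph.equality) auto
qed auto

lemma cycle_graph_rev: "cycle_graph (rev vs) = cycle_graph vs"
proof (cases vs)
  case (Cons v ws)
  have "cycle_graph (rev vs) = cycle_graph (v # rev ws)"
    using cycle_graph_rotate[of "rev ws" "[v]"] by (simp add: Cons)
  moreover have "edges (cycle_graph (v # rev ws)) = edges (cycle_graph vs)"
    using path_edges_rev[of "v # ws @ [v]"] by (simp add: Cons edges_cycle_graph)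
  ultimately show ?thesis
    by (intro ugraph.equality) (auto simp: Cons)
qed auto

text \<open>Rotation, and reversal if the orientation is wrong, makes the given edge the closing one
  of the walk. In this form a path from \<open>u\<close> to \<open>v\<close> is inserted by
  appending it to the list.\<close>

lemma cycle_graph_at_edge:
  assumes "distinct vs" "3 \<le> length vs" "{u, v} \<in> edges (cycle_graph vs)"
  obtains ws where "distinct (v # ws @ [u])" "ws \<noteq> []" "cycle_graph vs = cycle_graph (v # ws @ [u])"
proof -
  have "\<exists>x y ws. {u, v} = {x, y} \<and> distinct (y # ws @ [x]) \<and> ws \<noteq> [] \<and>
      cycle_graph vs = cycle_graph (y # ws @ [x])"
  proof -
    obtain w vs' where vs: "vs = w # vs'" using assms(2) by (cases vs) auto
    obtain xs ys x y where *: "w # vs' @ [w] = xs @ x # y # ys" "{u, v} = {x, y}"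
      using assms(3) unfolding vs edges_cycle_graph by (rule path_edges_cases)
    show ?thesis
    \<comment> \<open>If nothing follows \<open>y\<close>, the edge is the closing one and
      \<open>y\<close> is the first vertex; otherwise the edge lies inside \<open>vs\<close> and
      rotation moves its ends to the ends of the list.\<close>
    proof (cases ys rule: rev_cases)
      case Nil
      with *(1) have "vs @ [w] = (xs @ [x]) @ [y]"
        unfolding vs by (metis append_Cons append_Nil append_assoc)
      then have eq: "vs = xs @ [x]" "y = w" by (simp_all only: append1_eq_conv)
      then obtain ws where ws: "xs = y # ws" "ws \<noteq> []"
        using assms(2) vs by (cases xs) (auto simp: Suc_le_eq)
      show ?thesis
        using assms(1) *(2) ws unfolding eq(1)
        by (intro exI[of _ x] exI[of _ y] exI[of _ ws]) auto
    next
      case (snoc ys' z)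
      with *(1) have "vs @ [w] = (xs @ x # y # ys') @ [z]"
        unfolding vs by (metis append_Cons append_assoc)
      then have eq: "vs = xs @ x # y # ys'" by (simp only: append1_eq_conv)
      then have "cycle_graph vs = cycle_graph (y # (ys' @ xs) @ [x])"
        using cycle_graph_rotate[of "xs @ [x]" "y # ys'"] by simp
      moreover have "distinct (y # (ys' @ xs) @ [x])" "ys' @ xs \<noteq> []"
        using assms(1,2) eq by auto
      ultimately show ?thesis using *(2) by blast
    qed
  qed
  then obtain x y ws where *: "{u, v} = {x, y}" "distinct (y # ws @ [x])" "ws \<noteq> []"
      "cycle_graph vs = cycle_graph (y # ws @ [x])" by blast
  show ?thesis
  \<comment> \<open>The edge determines its ends only up to order; in the swapped case the walk is
    read backwards.\<close>
  proof (cases "x = u")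
    case True
    with *(1) have "y = v" by (auto simp: doubleton_eq_iff)
    with True * that[of ws] show ?thesis by simp
  next
    case False
    with *(1) have "x = v" "y = u" by (auto simp: doubleton_eq_iff)
    with * that[of "rev ws"] cycle_graph_rev[of "y # ws @ [x]"] show ?thesis by auto
  qed
qed

text \<open>With \<open>v\<close> rotated to the front, only the first and the closing edge contain
  it; these differ because there are at least three distinct vertices.\<close>

lemma valency_cycle_graph:
  assumes "distinct vs" "3 \<le> length vs" "v \<in> set vs"
  shows "card {e \<in> edges (cycle_graph vs). v \<in> e} = 2"
proof -
  obtain xs ys where "vs = xs @ v # ys" using assms(3) by (meson split_list)
  then have eq: "cycle_graph vs = cycle_graph (v # ys @ xs)"
    "distinct (v # ys @ xs)" "3 \<le> length (v # ys @ xs)"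
    using assms cycle_graph_rotate[of xs "v # ys"] by auto
  then obtain w ws z where ws: "ys @ xs = w # ws @ [z]"
    by (cases "ys @ xs"; cases "tl (ys @ xs)" rule: rev_cases) auto
  have "{e \<in> edges (cycle_graph vs). v \<in> e} = {{v, w}, {z, v}}"
    using eq(2) path_edges_append[of "v # w # ws" z "[v]"] path_edges_subset[of _ "w # ws @ [z]"]
    unfolding eq(1) edges_cycle_graph ws by auto
  moreover have "{v, w} \<noteq> {z, v}"
    using eq(2) ws by (auto simp: doubleton_eq_iff)
  ultimately show ?thesis by simp
qed

lemma simple_graph_cycle_graph:
  assumes "distinct vs" "3 \<le> length vs"
  shows "simple_graph (cycle_graph vs)"
proof -
  have "e \<subseteq> set vs \<and> card e = 2" if e: "e \<in> edges (cycle_graph vs)" for e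
  proof -
    obtain i where i: "i < length vs" "e = {vs ! i, vs ! (Suc i mod length vs)}"
      using e by (auto simp: cycle_graph_def)
    then obtain x y where "e = {x, y}" "e \<subseteq> set vs"
      using assms(2) by (metis empty_subsetI insert_subset length_greater_0_conv list.size(3)
          mod_less_divisor not_less0 nth_mem)
    \<comment> \<open>Both ends of the edge occur in one distinct list, so they differ.\<close>
    moreover from this e assms obtain ws where "distinct (y # ws @ [x])"
      by (metis cycle_graph_at_edge)
    ultimately show ?thesis by auto
  qed
  then show ?thesis by (simp add: simple_graph_def)
qed

section \<open>Separating 2-factors\<close>

text \<open>Simplicity and valency 2 of \<open>F\<close> come from its decomposition into cycles;
  \<open>spanning_cyclableI\<close> recovers them through \<open>separates_regular\<close>.\<close>

definition separable :: "'a ugraph \<Rightarrow> 'a set \<Rightarrow> bool" where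
  "separable X A \<longleftrightarrow> (\<exists>F. separates F A \<and> verts F = verts X \<and> edges F \<subseteq> edges X)"

lemma consists_of_cycles_regular:
  assumes "consists_of_cycles F Cs"
  shows "simple_graph F" and "v \<in> verts F \<Longrightarrow> valency F v = 2"
proof -
  have cyc: "\<exists>vs. distinct vs \<and> 3 \<le> length vs \<and> C = cycle_graph vs" if "C \<in> Cs" for C
    using assms that by (auto simp: consists_of_cycles_def is_cycle_graph_def)
  then have simple: "simple_graph C" if "C \<in> Cs" for C
    using simple_graph_cycle_graph that by blast
  then show "simple_graph F"
    using assms unfolding consists_of_cycles_def simple_graph_def by fastforce
  show "valency F v = 2" if v: "v \<in> verts F"
  proof -
    obtain C where C: "C \<in> Cs" "v \<in> verts C"
      using assms v unfolding consists_of_cycles_def by blast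
    \<comment> \<open>An edge of a cycle \<open>D\<close> at \<open>v\<close> puts \<open>v\<close>
      into \<open>D\<close>, and disjointness forces \<open>D = C\<close>; so the valency can be
      counted within \<open>C\<close>.\<close>
    have "e \<in> edges C" if "D \<in> Cs" "e \<in> edges D" "v \<in> e" for D e
    proof -
      have "v \<in> verts D" using simple[OF that(1)] that(2,3) by (auto simp: simple_graph_def)
      with C that(1) assms have "D = C" unfolding consists_of_cycles_def by blast
      with that(2) show ?thesis by simp
    qed
    then have "{e \<in> edges F. v \<in> e} = {e \<in> edges C. v \<in> e}"
      using assms C(1) by (auto simp: consists_of_cycles_def)
    moreover obtain vs where "distinct vs" "3 \<le> length vs" "C = cycle_graph vs"
      using cyc[OF C(1)] by blast
    ultimately show ?thesis
      using C(2) valency_cycle_graph[of vs v] by (simp add: valency_def)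
  qed
qed

lemma separates_regular:
  assumes "separates F A"
  shows "simple_graph F" and "v \<in> verts F \<Longrightarrow> valency F v = 2"
  using assms consists_of_cycles_regular by (auto simp: separates_def)

lemma spanning_cyclableI:
  assumes "\<And>A. A \<subseteq> verts X \<Longrightarrow> finite A \<Longrightarrow> card A = k \<Longrightarrow> separable X A"
  shows "spanning_cyclable k X"
  unfolding spanning_cyclable_def two_factor_def spanning_subgraph_def
  using assms separates_regular unfolding separable_def by metis

text \<open>One cycle is lengthened by new vertices outside \<open>A\<close>: it meets
  \<open>A\<close> as before, and neither the number of cycles nor their disjointness
  changes.\<close>

lemma separates_splice:
  assumes sep: "separates F A" and uv: "{u, v} \<in> edges F"
    and p: "distinct p" "set p \<inter> verts F = {}" "set p \<inter> A = {}"
  shows "separates \<lparr>verts = verts F \<union> set p,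
           edges = (edges F - {{u, v}}) \<union> path_edges (u # p @ [v])\<rparr> A"
proof -
  from sep obtain Cs where Cs: "finite Cs" "card Cs = card A" "consists_of_cycles F Cs"
    "\<forall>C \<in> Cs. card (A \<inter> verts C) = 1" by (auto simp: separates_def)
  note cons = Cs(3)[unfolded consists_of_cycles_def]
  obtain C where C: "C \<in> Cs" "{u, v} \<in> edges C" using cons uv by auto
  then obtain vs where "distinct vs" "3 \<le> length vs" "C = cycle_graph vs"
    using cons by (auto simp: is_cycle_graph_def)
  then obtain ws where ws: "distinct (v # ws @ [u])" "ws \<noteq> []" "C = cycle_graph (v # ws @ [u])"
    using C(2) by (metis cycle_graph_at_edge)
  \<comment> \<open>The closing edge of \<open>v # ws @ [u]\<close> runs from \<open>u\<close> to
    \<open>v\<close>; appending \<open>p\<close> replaces just this edge by the path through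
    \<open>p\<close>.\<close>
  define C' where "C' = cycle_graph (v # ws @ [u] @ p)"
  have verts_C': "verts C' = verts C \<union> set p" by (auto simp: C'_def ws(3))
  \<comment> \<open>Since \<open>ws\<close> is nonempty, the walk does not use the edge a second
    time, so deleting it leaves the rest of the cycle intact.\<close>
  have "{u, v} \<notin> path_edges (v # ws @ [u])"
    using ws(1,2) path_edges_subset[of _ "ws @ [u]"]
    by (cases ws) (auto simp: doubleton_eq_iff)
  moreover have "edges C = insert {u, v} (path_edges (v # ws @ [u]))"
    using path_edges_append[of "v # ws" u "[v]"] by (auto simp: ws(3) edges_cycle_graph)
  moreover have "edges C' = path_edges (v # ws @ [u]) \<union> path_edges (u # p @ [v])"
    using path_edges_append[of "v # ws" u "p @ [v]"] by (simp add: C'_def edges_cycle_graph)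
  ultimately have edges_C': "edges C' = (edges C - {{u, v}}) \<union> path_edges (u # p @ [v])"
    by auto
  have vC: "verts C \<subseteq> verts F" using cons C(1) by auto
  have uvC: "u \<in> verts C" "v \<in> verts C" by (simp_all add: ws(3))
  have cyc': "is_cycle_graph C'"
    unfolding is_cycle_graph_def C'_def using ws p vC
    by (intro exI[of _ "v # ws @ [u] @ p"]) (cases ws; auto)
  have others: "verts C' \<inter> verts D = {}" "{u, v} \<notin> edges D" if "D \<in> Cs - {C}" for D
  proof -
    have "verts C \<inter> verts D = {}" "verts D \<subseteq> verts F" using cons C(1) that by auto
    moreover have "\<forall>e \<in> edges D. e \<subseteq> verts D"
      using cons that simple_graph_cycle_graph unfolding is_cycle_graph_def simple_graph_def
      by (metis DiffD1)
    moreover from calculation uvC have "\<not> {u, v} \<subseteq> verts D" by blast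
    ultimately show "verts C' \<inter> verts D = {}" "{u, v} \<notin> edges D"
      using p(2) unfolding verts_C' by blast+
  qed
  \<comment> \<open>A nonempty cycle disjoint from all the others is not one of them, so exchanging
    \<open>C\<close> for \<open>C'\<close> keeps the count.\<close>
  have C'_new: "C' \<notin> Cs - {C}" using others(1)[of C'] by (auto simp: C'_def)
  let ?F = "\<lparr>verts = verts F \<union> set p, edges = (edges F - {{u, v}}) \<union> path_edges (u # p @ [v])\<rparr>"
  have "consists_of_cycles ?F (insert C' (Cs - {C}))"
    unfolding consists_of_cycles_def
  proof (intro conjI)
    show "\<forall>D \<in> insert C' (Cs - {C}). is_cycle_graph D" using cyc' cons by auto
    show "\<forall>D \<in> insert C' (Cs - {C}). \<forall>E \<in> insert C' (Cs - {C}). D \<noteq> E \<longrightarrow> verts D \<inter> verts E = {}"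
    proof (intro ballI impI)
      fix D E assume "D \<in> insert C' (Cs - {C})" "E \<in> insert C' (Cs - {C})" "D \<noteq> E"
      then consider "D = C'" "E \<in> Cs - {C}" | "E = C'" "D \<in> Cs - {C}" | "D \<in> Cs" "E \<in> Cs" by auto
      then show "verts D \<inter> verts E = {}"
      proof cases
        case 1
        then show ?thesis using others(1) by simp
      next
        case 2
        then show ?thesis using others(1)[of D] by (simp add: Int_commute)
      next
        case 3
        then show ?thesis using cons \<open>D \<noteq> E\<close> by simp
      qed
    qed
    show "verts ?F = (\<Union>D \<in> insert C' (Cs - {C}). verts D)"
      using cons C(1) by (auto simp: verts_C')
    show "edges ?F = (\<Union>D \<in> insert C' (Cs - {C}). edges D)"
      using cons C(1) others(2) by (auto simp: edges_C')
  qed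
  moreover have "card (insert C' (Cs - {C})) = card A"
    using Cs(1,2) C(1) C'_new by (metis card.insert card.remove finite_Diff)
  moreover have "A \<inter> verts C' = A \<inter> verts C" using p(3) by (auto simp: verts_C')
  ultimately show ?thesis
    unfolding separates_def using Cs(1,4) C(1)
    by (intro exI[of _ "insert C' (Cs - {C})"]) auto
qed

text \<open>Distinct edges and disjoint new paths make the splices independent, so they can be
  performed one after another. An inclusion suffices for the edges, as the result only has to lie in
  a given graph.\<close>

lemma separates_splices:
  assumes "separates F A" "A \<subseteq> verts F"
    and "\<forall>(u, v, p) \<in> set ts. {u, v} \<in> edges F"
    and "distinct (map (\<lambda>(u, v, p). {u, v}) ts)"
    and "distinct (concat (map (\<lambda>(u, v, p). p) ts))"
    and "(\<Union>(u, v, p) \<in> set ts. set p) \<inter> verts F = {}"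
  shows "\<exists>F'. separates F' A \<and> verts F' = verts F \<union> (\<Union>(u, v, p) \<in> set ts. set p) \<and>
    edges F' \<subseteq> (edges F - (\<Union>(u, v, p) \<in> set ts. {{u, v}})) \<union>
      (\<Union>(u, v, p) \<in> set ts. path_edges (u # p @ [v]))"
  using assms
proof (induction ts arbitrary: F)
  case Nil
  then show ?case by auto
next
  case (Cons t ts)
  obtain u v p where t: "t = (u, v, p)" by (cases t)
  define F1 where "F1 = \<lparr>verts = verts F \<union> set p,
    edges = (edges F - {{u, v}}) \<union> path_edges (u # p @ [v])\<rparr>"
  have sep1: "separates F1 A"
    unfolding F1_def using Cons.prems by (intro separates_splice) (auto simp: t)
  have IH: "\<exists>F'. separates F' A \<and> verts F' = verts F1 \<union> (\<Union>(u, v, p) \<in> set ts. set p) \<and>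
    edges F' \<subseteq> (edges F1 - (\<Union>(u, v, p) \<in> set ts. {{u, v}})) \<union>
      (\<Union>(u, v, p) \<in> set ts. path_edges (u # p @ [v]))"
  proof (rule Cons.IH[OF sep1])
    \<comment> \<open>The remaining edges differ from \<open>{u, v}\<close> and hence survive the
      first splice.\<close>
    have "{a, b} \<in> (\<lambda>(u, v, p). {u, v}) ` set ts" if "(a, b, q) \<in> set ts" for a b q
      using that by (rule rev_image_eqI) simp
    then have "{a, b} \<noteq> {u, v}" if "(a, b, q) \<in> set ts" for a b q
      using Cons.prems(4) that unfolding t
      by (metis (no_types, lifting) case_prod_conv distinct.simps(2) list.simps(9) set_map)
    then show "\<forall>(u, v, p) \<in> set ts. {u, v} \<in> edges F1"
      using Cons.prems(3) by (auto simp: F1_def)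
    have "set q \<inter> set p = {}" if "(a, b, q) \<in> set ts" for a b q
      using Cons.prems(5) that by (fastforce simp: t)
    then show "(\<Union>(u, v, p) \<in> set ts. set p) \<inter> verts F1 = {}"
      using Cons.prems(6) by (auto simp: F1_def)
  qed (use Cons.prems in \<open>auto simp: F1_def\<close>)
  from IH obtain F' where F': "separates F' A"
    "verts F' = verts F1 \<union> (\<Union>(u, v, p) \<in> set ts. set p)"
    "edges F' \<subseteq> (edges F1 - (\<Union>(u, v, p) \<in> set ts. {{u, v}})) \<union>
      (\<Union>(u, v, p) \<in> set ts. path_edges (u # p @ [v]))" by blast
  show ?case
  proof (intro exI[of _ F'] conjI)
    show "separates F' A" by fact
    show "verts F' = verts F \<union> (\<Union>(u, v, p) \<in> set (t # ts). set p)"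
      using F'(2) by (auto simp: F1_def t)
    show "edges F' \<subseteq> (edges F - (\<Union>(u, v, p) \<in> set (t # ts). {{u, v}})) \<union>
      (\<Union>(u, v, p) \<in> set (t # ts). path_edges (u # p @ [v]))"
      using F'(3) unfolding F1_def t by auto
  qed
qed

section \<open>Automorphisms\<close>

definition map_ugraph :: "('a \<Rightarrow> 'b) \<Rightarrow> 'a ugraph \<Rightarrow> 'b ugraph" where
  "map_ugraph f G = \<lparr>verts = f ` verts G, edges = (`) f ` edges G\<rparr>"

lemma map_ugraph_cycle_graph: "map_ugraph f (cycle_graph vs) = cycle_graph (map f vs)"
proof (cases vs)
  case (Cons v ws)
  have "edges (map_ugraph f (cycle_graph vs)) = edges (cycle_graph (map f vs))"
    using path_edges_map[of f "v # ws @ [v]"] by (simp add: Cons map_ugraph_def edges_cycle_graph)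
  then show ?thesis by (intro ugraph.equality) (auto simp: map_ugraph_def)
qed (simp add: map_ugraph_def cycle_graph_def)

text \<open>Images of cycles are cycles, and injectivity of \<open>f\<close> preserves disjointness
  and the sizes of the intersections with \<open>A\<close>.\<close>

lemma separable_image:
  assumes sep: "separable X A" and A: "A \<subseteq> verts X"
    and inj: "inj_on f (verts X)"
    and verts: "f ` verts X = verts X"
    and edges: "\<And>e. e \<in> edges X \<Longrightarrow> f ` e \<in> edges X"
  shows "separable X (f ` A)"
proof -
  from sep obtain F Cs where F: "verts F = verts X" "edges F \<subseteq> edges X"
    and Cs: "finite Cs" "card Cs = card A" "consists_of_cycles F Cs"
      "\<forall>C \<in> Cs. card (A \<inter> verts C) = 1" by (auto simp: separable_def separates_def)
  note cons = Cs(3)[unfolded consists_of_cycles_def]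
  have sub: "verts C \<subseteq> verts X" if "C \<in> Cs" for C using cons F(1) that by auto
  have disj: "verts (map_ugraph f C) \<inter> verts (map_ugraph f D) = {}"
    if "C \<in> Cs" "D \<in> Cs" "C \<noteq> D" for C D
  proof -
    have "verts C \<inter> verts D = {}" using cons that by blast
    then show ?thesis
      using inj_on_image_Int[OF inj sub[OF that(1)] sub[OF that(2)]] by (simp add: map_ugraph_def)
  qed
  have cyc: "is_cycle_graph (map_ugraph f C)" if C: "C \<in> Cs" for C
  proof -
    obtain vs where "distinct vs" "3 \<le> length vs" "C = cycle_graph vs"
      using cons C by (auto simp: is_cycle_graph_def)
    then show ?thesis
      using sub[OF C] inj unfolding is_cycle_graph_def
      by (intro exI[of _ "map f vs"])
        (auto simp: map_ugraph_cycle_graph distinct_map intro: inj_on_subset)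
  qed
  have card1: "card (f ` A \<inter> verts (map_ugraph f C)) = 1" if C: "C \<in> Cs" for C
  proof -
    have "f ` A \<inter> verts (map_ugraph f C) = f ` (A \<inter> verts C)"
      using inj_on_image_Int[OF inj A sub[OF C]] by (simp add: map_ugraph_def)
    moreover have "inj_on f (A \<inter> verts C)" using inj A by (meson Int_lower1 inj_on_subset subset_trans)
    ultimately show ?thesis using Cs(4) C by (simp add: card_image)
  qed
  \<comment> \<open>Different cycles have disjoint images, and every image contains a vertex of the
    image of \<open>A\<close>, so no two images coincide.\<close>
  have "inj_on (map_ugraph f) Cs"
  proof (rule inj_onI, rule ccontr)
    fix C D assume CD: "C \<in> Cs" "D \<in> Cs" "map_ugraph f C = map_ugraph f D" "C \<noteq> D"
    with disj[of C D] card1[OF CD(1)] show False by auto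
  qed
  then have "card (map_ugraph f ` Cs) = card (f ` A)"
    using Cs(2) inj A by (metis card_image inj_on_subset)
  moreover have "consists_of_cycles (map_ugraph f F) (map_ugraph f ` Cs)"
    unfolding consists_of_cycles_def
  proof (intro conjI)
    show "\<forall>C \<in> map_ugraph f ` Cs. is_cycle_graph C" using cyc by blast
    show "\<forall>C \<in> map_ugraph f ` Cs. \<forall>D \<in> map_ugraph f ` Cs. C \<noteq> D \<longrightarrow> verts C \<inter> verts D = {}"
      using disj by blast
    show "verts (map_ugraph f F) = (\<Union>C \<in> map_ugraph f ` Cs. verts C)"
      using cons by (auto simp: map_ugraph_def)
    show "edges (map_ugraph f F) = (\<Union>C \<in> map_ugraph f ` Cs. edges C)"
      using cons by (auto simp: map_ugraph_def)
  qed
  ultimately have "separates (map_ugraph f F) (f ` A)"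
    unfolding separates_def using Cs(1) card1 by (intro exI[of _ "map_ugraph f ` Cs"]) auto
  then show ?thesis
    unfolding separable_def using F verts edges
    by (intro exI[of _ "map_ugraph f F"]) (auto simp: map_ugraph_def)
qed

section \<open>The twisted grid\<close>

text \<open>Gluing the ends of the cylinder along the reflection \<open>3 - j\<close> gives a grid
  on the Klein bottle.\<close>

abbreviation klein_grid :: "nat \<Rightarrow> (nat \<times> nat) ugraph" where
  "klein_grid m \<equiv> twisted_box m tau_refl 4"

text \<open>A form of the edge relation on ordered pairs that simplification and code evaluation can
  decide; listing both orientations makes it symmetric.\<close>

definition adj :: "nat \<Rightarrow> nat \<times> nat \<Rightarrow> nat \<times> nat \<Rightarrow> bool" where
  "adj m = (\<lambda>(i, j) (i', j'). i < m \<and> i' < m \<and> j < 4 \<and> j' < 4 \<and>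
     (i' = i \<and> (j' = Suc j mod 4 \<or> j = Suc j' mod 4) \<or>
      j' = j \<and> (i' = Suc i \<or> i = Suc i') \<or>
      j' = 3 - j \<and> (Suc i = m \<and> i' = 0 \<or> Suc i' = m \<and> i = 0)))"

lemma less_4_iff: "(j::nat) < 4 \<longleftrightarrow> j = 0 \<or> j = 1 \<or> j = 2 \<or> j = 3"
  by auto

lemma tau_refl_eq: "j < 4 \<Longrightarrow> tau_refl j = 3 - j"
  by (auto simp: less_4_iff tau_refl_def transpose_def)

lemma verts_klein_grid: "verts (klein_grid m) = {0..<m} \<times> {0..<4}"
  by (simp add: twisted_box_def path_box_cycle_def)

lemma adj_sym: "adj m u v \<Longrightarrow> adj m v u"
  by (auto simp: adj_def)

lemma edges_klein_grid:
  assumes "0 < m"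
  shows "edges (klein_grid m) = {{u, v} |u v. adj m u v}"
proof
  show "edges (klein_grid m) \<subseteq> {{u, v} |u v. adj m u v}"
  proof
    fix e assume "e \<in> edges (klein_grid m)"
    then consider i j where "e = {(i, j), (i, Suc j mod 4)}" "i < m" "j < 4"
      | i j where "e = {(i, j), (Suc i, j)}" "Suc i < m" "j < 4"
      | j where "e = {(m - 1, j), (0, tau_refl j)}" "j < 4"
      by (auto simp: twisted_box_def path_box_cycle_def)
    then show "e \<in> {{u, v} |u v. adj m u v}"
    proof cases
      case (1 i j)
      then have "adj m (i, j) (i, Suc j mod 4)" by (simp add: adj_def)
      with 1 show ?thesis by blast
    next
      case (2 i j)
      then have "adj m (i, j) (Suc i, j)" by (simp add: adj_def)
      with 2 show ?thesis by blast
    next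
      case (3 j)
      then have "adj m (m - 1, j) (0, tau_refl j)" using assms by (simp add: adj_def tau_refl_eq)
      with 3 show ?thesis by blast
    qed
  qed
  show "{{u, v} |u v. adj m u v} \<subseteq> edges (klein_grid m)"
  proof
    fix e assume "e \<in> {{u, v} |u v. adj m u v}"
    then obtain i j i' j' where e: "e = {(i, j), (i', j')}" and "adj m (i, j) (i', j')"
      by auto
    then consider "i < m" "j < 4" "i' = i" "j' = Suc j mod 4"
      | "i < m" "j' < 4" "i' = i" "j = Suc j' mod 4"
      | "i' < m" "j < 4" "j' = j" "i' = Suc i"
      | "i < m" "j < 4" "j' = j" "i = Suc i'"
      | "j < 4" "j' = tau_refl j" "i = m - 1" "i' = 0"
      | "j' < 4" "j = tau_refl j'" "i' = m - 1" "i = 0"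
      by (auto simp: adj_def tau_refl_eq)
    then show "e \<in> edges (klein_grid m)"
      unfolding e twisted_box_def path_box_cycle_def
      by cases (auto simp: insert_commute)
  qed
qed

lemma edge_iff_adj:
  assumes "0 < m"
  shows "{u, v} \<in> edges (klein_grid m) \<longleftrightarrow> adj m u v"
proof
  assume "{u, v} \<in> edges (klein_grid m)"
  then obtain a b where "{u, v} = {a, b}" "adj m a b"
    unfolding edges_klein_grid[OF assms] by blast
  then show "adj m u v" using adj_sym[of m a b] by (auto simp: doubleton_eq_iff)
qed (unfold edges_klein_grid[OF assms], blast)

lemma path_edges_subset_iff_adj:
  "0 < m \<Longrightarrow> path_edges xs \<subseteq> edges (klein_grid m) \<longleftrightarrow> successively (adj m) xs"
  by (induction xs rule: path_edges.induct) (auto simp: edge_iff_adj)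

text \<open>The 2-factor for the image of \<open>A\<close> under \<open>g\<close> is carried back by
  the inverse \<open>f\<close>, so only \<open>f\<close> has to be checked on edges.\<close>

lemma separable_automorphism:
  assumes "0 < m" and A: "A \<subseteq> verts (klein_grid m)"
    and f: "\<And>u v. adj m u v \<Longrightarrow> adj m (f u) (f v)"
    and g: "\<And>v. v \<in> verts (klein_grid m) \<Longrightarrow>
      g v \<in> verts (klein_grid m) \<and> f v \<in> verts (klein_grid m) \<and> f (g v) = v \<and> g (f v) = v"
    and sep: "separable (klein_grid m) (g ` A)"
  shows "separable (klein_grid m) A"
proof -
  have "separable (klein_grid m) (f ` g ` A)"
  proof (rule separable_image[OF sep])
    show "g ` A \<subseteq> verts (klein_grid m)" using A g by blast
    show "inj_on f (verts (klein_grid m))" using g by (intro inj_on_inverseI[where g = g]) blast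
    show "f ` verts (klein_grid m) = verts (klein_grid m)"
    proof
      show "verts (klein_grid m) \<subseteq> f ` verts (klein_grid m)"
        using g by (metis image_eqI subsetI)
    qed (use g in blast)
    show "f ` e \<in> edges (klein_grid m)" if "e \<in> edges (klein_grid m)" for e
    proof -
      from that obtain u v where "e = {u, v}" "adj m u v"
        using \<open>0 < m\<close> by (auto simp: edges_klein_grid)
      then show ?thesis using f edge_iff_adj[OF \<open>0 < m\<close>] by simp
    qed
  qed
  moreover have "f ` g ` A = A"
  proof -
    have "f (g v) = v" if "v \<in> A" for v using A g that by blast
    then show ?thesis by (simp add: image_image)
  qed
  ultimately show ?thesis by simp
qed

section \<open>Symmetries of the twisted grid and vertex-transitivity\<close>

definition row_succ :: "nat \<Rightarrow> nat \<times> nat \<Rightarrow> nat \<times> nat" where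
  "row_succ m = (\<lambda>(i, j). if Suc i = m then (0, 3 - j) else (Suc i, j))"

definition row_pred :: "nat \<Rightarrow> nat \<times> nat \<Rightarrow> nat \<times> nat" where
  "row_pred m = (\<lambda>(i, j). if i = 0 then (m - 1, 3 - j) else (i - 1, j))"

lemma row_succ_in_verts: "v \<in> verts (klein_grid m) \<Longrightarrow> row_succ m v \<in> verts (klein_grid m)"
  by (auto simp: verts_klein_grid row_succ_def)

text \<open>The reflection applied on leaving row 0 preserves the 4-cycle of a row and matches
  vertical edges with wrap edges. This is the direction that carries 2-factors back in
  \<open>separable_row_succ\<close>.\<close>

lemma adj_row_pred:
  assumes "adj m u v"
  shows "adj m (row_pred m u) (row_pred m v)"
proof -
  obtain i j i' j' where uv: "u = (i, j)" "v = (i', j')" by fastforce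
  with assms have "j = 0 \<or> j = 1 \<or> j = 2 \<or> j = 3" "j' = 0 \<or> j' = 1 \<or> j' = 2 \<or> j' = 3"
    by (auto simp: adj_def less_4_iff)
  then show ?thesis
    using assms unfolding uv adj_def row_pred_def
    by (elim disjE; cases "i = 0"; cases "i' = 0") auto
qed

lemma separable_row_succ:
  assumes "A \<subseteq> verts (klein_grid m)" "separable (klein_grid m) (row_succ m ` A)" "0 < m"
  shows "separable (klein_grid m) A"
  using assms(3,1) adj_row_pred _ assms(2)
  by (rule separable_automorphism) (auto simp: verts_klein_grid row_succ_def row_pred_def)

lemma separable_row_succ_funpow:
  assumes "A \<subseteq> verts (klein_grid m)" "separable (klein_grid m) ((row_succ m ^^ r) ` A)" "0 < m"
  shows "separable (klein_grid m) A"
  using assms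
proof (induction r arbitrary: A)
  case (Suc r)
  then have "separable (klein_grid m) ((row_succ m ^^ r) ` row_succ m ` A)"
    by (simp add: image_image funpow_swap1)
  moreover have "row_succ m ` A \<subseteq> verts (klein_grid m)"
    using Suc.prems(1) row_succ_in_verts by blast
  ultimately have "separable (klein_grid m) (row_succ m ` A)" using Suc by blast
  then show ?case using separable_row_succ Suc.prems by blast
qed simp

lemma row_succ_funpow:
  assumes "v \<in> verts (klein_grid m)"
  shows "(row_succ m ^^ r) v \<in> verts (klein_grid m) \<and> fst ((row_succ m ^^ r) v) = (fst v + r) mod m"
proof (induction r)
  case 0
  then show ?case using assms by (auto simp: verts_klein_grid)
next
  case (Suc r)
  obtain i j where ij: "(row_succ m ^^ r) v = (i, j)" by fastforce
  with Suc row_succ_in_verts[of "(i, j)" m] show ?case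
    by (auto simp: row_succ_def mod_Suc)
qed

text \<open>Rotation by 2 commutes with the reflection \<open>3 - j\<close> modulo 4, while rotation
  by 1 does not.\<close>

definition column_half_turn :: "nat \<times> nat \<Rightarrow> nat \<times> nat" where
  "column_half_turn = (\<lambda>(i, j). (i, (j + 2) mod 4))"

lemma adj_column_half_turn:
  assumes "adj m u v"
  shows "adj m (column_half_turn u) (column_half_turn v)"
proof -
  obtain i j i' j' where uv: "u = (i, j)" "v = (i', j')" by fastforce
  with assms have "j = 0 \<or> j = 1 \<or> j = 2 \<or> j = 3" "j' = 0 \<or> j' = 1 \<or> j' = 2 \<or> j' = 3"
    by (auto simp: adj_def less_4_iff)
  then show ?thesis
    using assms unfolding uv adj_def column_half_turn_def
    by (elim disjE) simp_all
qed

lemma separable_column_half_turn: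
  assumes "A \<subseteq> verts (klein_grid m)" "separable (klein_grid m) (column_half_turn ` A)" "0 < m"
  shows "separable (klein_grid m) A"
  using assms(3,1) adj_column_half_turn _ assms(2)
  by (rule separable_automorphism) (auto simp: verts_klein_grid column_half_turn_def less_4_iff)

lemma card_column_half_turn:
  assumes "A \<subseteq> verts (klein_grid m)"
  shows "card (column_half_turn ` A) = card A"
proof (rule card_image)
  have "inj_on column_half_turn (verts (klein_grid m))"
    by (auto simp: inj_on_def verts_klein_grid column_half_turn_def less_4_iff)
  with assms show "inj_on column_half_turn A" by (rule inj_on_subset[rotated])
qed

lemma card_row_succ_funpow:
  assumes "A \<subseteq> verts (klein_grid m)"
  shows "card ((row_succ m ^^ r) ` A) = card A"
proof (rule card_image)
  have inj: "inj_on (row_succ m) (verts (klein_grid m))"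
    by (auto simp: inj_on_def verts_klein_grid row_succ_def less_4_iff)
  have "inj_on (row_succ m ^^ r) (verts (klein_grid m))"
  proof (induction r)
    case (Suc r)
    moreover have "(row_succ m ^^ r) ` verts (klein_grid m) \<subseteq> verts (klein_grid m)"
      using row_succ_funpow by blast
    ultimately show ?case
      using inj unfolding funpow.simps by (intro comp_inj_on) (auto intro: inj_on_subset)
  qed simp
  with assms show "inj_on (row_succ m ^^ r) A" by (rule inj_on_subset[rotated])
qed

text \<open>Going up to row 0 wraps around once and so reflects once; for \<open>i = 0\<close> this
  is a full turn.\<close>

lemma row_succ_funpow_wrap:
  assumes "i < m"
  shows "(row_succ m ^^ (m - i)) (i, j) = (0, 3 - j)"
proof -
  have "(row_succ m ^^ r) (i, j) = (i + r, j)" if "i + r < m" for r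
    using that by (induction r) (auto simp: row_succ_def)
  from this[of "m - i - 1"] assms have "(row_succ m ^^ Suc (m - i - 1)) (i, j) = (0, 3 - j)"
    by (simp add: row_succ_def)
  with assms show ?thesis by (simp add: Suc_diff_Suc)
qed

lemma separable_wlog_origin:
  assumes "0 < m" "0 < k" and A: "A \<subseteq> verts (klein_grid m)" "card A = k"
    and origin: "\<And>B. B \<subseteq> verts (klein_grid m) \<Longrightarrow> card B = k \<Longrightarrow> (0, 0) \<in> B \<Longrightarrow>
      separable (klein_grid m) B"
  shows "separable (klein_grid m) A"
proof -
  define ok where "ok v \<longleftrightarrow> (\<forall>B. B \<subseteq> verts (klein_grid m) \<longrightarrow> card B = k \<longrightarrow> v \<in> B \<longrightarrow>
    separable (klein_grid m) B)" for v
  have "ok (0, 0)" using origin by (auto simp: ok_def)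
  have "ok (0, 2)"
    unfolding ok_def
  proof (intro allI impI)
    fix B assume B: "B \<subseteq> verts (klein_grid m)" "card B = k" "(0, 2) \<in> B"
    have "(0, 0) \<in> column_half_turn ` B"
      using B(3) by (rule rev_image_eqI) (simp add: column_half_turn_def)
    moreover have "column_half_turn ` B \<subseteq> verts (klein_grid m)"
      using B(1) by (auto simp: verts_klein_grid column_half_turn_def)
    ultimately have "separable (klein_grid m) (column_half_turn ` B)"
      using origin card_column_half_turn[OF B(1)] B(2) by simp
    then show "separable (klein_grid m) B"
      using separable_column_half_turn B(1) \<open>0 < m\<close> by blast
  qed
  have shift: "ok (i, j)" if "ok (0, 3 - j)" "i < m" for i j
    unfolding ok_def
  proof (intro allI impI)
    fix B assume B: "B \<subseteq> verts (klein_grid m)" "card B = k" "(i, j) \<in> B"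
    let ?f = "row_succ m ^^ (m - i)"
    have "(0, 3 - j) \<in> ?f ` B"
      using B(3) by (rule rev_image_eqI) (simp add: row_succ_funpow_wrap that(2))
    moreover have "?f ` B \<subseteq> verts (klein_grid m)" using B(1) row_succ_funpow by blast
    ultimately have "separable (klein_grid m) (?f ` B)"
      using that(1) card_row_succ_funpow[OF B(1)] B(2) by (simp add: ok_def)
    then show "separable (klein_grid m) B"
      using separable_row_succ_funpow B(1) \<open>0 < m\<close> by blast
  qed
  \<comment> \<open>Columns 0 and 2 of row 0 give columns 3 and 1 of every row, row 0 included; from
    the latter, a second shift gives the even columns of every row.\<close>
  have odd: "ok (i, 1)" "ok (i, 3)" if "i < m" for i
    using shift[of 1 i] shift[of 3 i] \<open>ok (0, 0)\<close> \<open>ok (0, 2)\<close> that by (simp_all add: numeral_2_eq_2)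
  have even: "ok (i, 0)" "ok (i, 2)" if "i < m" for i
    using shift[of 0 i] shift[of 2 i] odd[of 0] \<open>0 < m\<close> that by (simp_all add: numeral_2_eq_2)
  have "A \<noteq> {}" using assms(2) A(2) by auto
  then obtain i j where ij: "(i, j) \<in> A" by auto
  with A(1) have "i < m" "j < 4" by (auto simp: verts_klein_grid)
  with odd even have "ok (i, j)" by (auto simp: less_4_iff)
  with A ij show ?thesis by (simp add: ok_def)
qed

section \<open>Inserting two rows\<close>

lemma adj_add_rows:
  assumes adj: "adj (Suc n) u v" and not_wrap: "\<And>j. j < 4 \<Longrightarrow> {u, v} \<noteq> {(n, j), (0, 3 - j)}"
  shows "adj (n + 3) u v"
proof -
  obtain i j i' j' where uv: "u = (i, j)" "v = (i', j')" by fastforce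
  have "\<not> (i = n \<and> i' = 0 \<and> j' = 3 - j)" if "j < 4"
    using not_wrap[OF that] by (auto simp: uv)
  moreover have "\<not> (i' = n \<and> i = 0 \<and> j = 3 - j')" if "j' < 4"
    using not_wrap[OF that] by (auto simp: uv)
  \<comment> \<open>Subtraction truncates, so the reflection is an involution only within the range
    of the columns.\<close>
  moreover have "j = 3 - j' \<longleftrightarrow> j' = 3 - j" if "j < 4" "j' < 4"
    using that by auto
  ultimately show ?thesis
    using adj unfolding uv adj_def by auto
qed

text \<open>Only wrap edges of the smaller graph can be missing from the larger one. It is therefore
  enough to splice at least those that \<open>F\<close> uses, by paths that together fill the two
  new rows.\<close>

lemma separable_add_rows_via:
  assumes "separates F A" "verts F = verts (klein_grid (Suc n))"
    "edges F \<subseteq> edges (klein_grid (Suc n))" "A \<subseteq> verts F"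
    and "\<forall>(u, v, p) \<in> set ts. {u, v} \<in> edges F"
    and "distinct (map (\<lambda>(u, v, p). {u, v}) ts)"
    and "distinct (concat (map (\<lambda>(u, v, p). p) ts))"
    and new: "set (concat (map (\<lambda>(u, v, p). p) ts)) = {Suc n, Suc (Suc n)} \<times> {0..<4}"
    and paths: "\<forall>(u, v, p) \<in> set ts. successively (adj (n + 3)) (u # p @ [v])"
    and wrap: "\<And>j. j < 4 \<Longrightarrow> {(n, j), (0, 3 - j)} \<in> edges F \<Longrightarrow>
      \<exists>p. ((n, j), (0, 3 - j), p) \<in> set ts"
  shows "separable (klein_grid (n + 3)) A"
proof -
  have new': "(\<Union>(u, v, p) \<in> set ts. set p) = {Suc n, Suc (Suc n)} \<times> {0..<4}"
  proof -
    have "(\<Union>(u, v, p) \<in> set ts. set p) = set (concat (map (\<lambda>(u, v, p). p) ts))"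
      by (induction ts) auto
    with new show ?thesis by (simp only:)
  qed
  have "(\<Union>(u, v, p) \<in> set ts. set p) \<inter> verts F = {}"
    unfolding new' assms(2) verts_klein_grid by auto
  with separates_splices[OF assms(1,4-7)] obtain F' where F': "separates F' A"
    "verts F' = verts F \<union> (\<Union>(u, v, p) \<in> set ts. set p)"
    "edges F' \<subseteq> (edges F - (\<Union>(u, v, p) \<in> set ts. {{u, v}})) \<union>
      (\<Union>(u, v, p) \<in> set ts. path_edges (u # p @ [v]))" by blast
  have "verts F' = verts (klein_grid (n + 3))"
    unfolding F'(2) new' assms(2) verts_klein_grid by auto
  moreover have "e \<in> edges (klein_grid (n + 3))" if "e \<in> edges F'" for e
  proof -
    from F'(3) that consider "e \<in> edges F" "e \<notin> (\<Union>(u, v, p) \<in> set ts. {{u, v}})"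
      | u v p where "(u, v, p) \<in> set ts" "e \<in> path_edges (u # p @ [v])" by blast
    then show ?thesis
    proof cases
      case 1
      then obtain u v where e: "e = {u, v}" "adj (Suc n) u v"
        using assms(3) by (auto simp: edges_klein_grid)
      have "e \<noteq> {(n, j), (0, 3 - j)}" if "j < 4" for j
      proof
        assume *: "e = {(n, j), (0, 3 - j)}"
        with wrap[OF that] 1(1) obtain p where "((n, j), (0, 3 - j), p) \<in> set ts" by auto
        with * 1(2) show False by blast
      qed
      with adj_add_rows[OF e(2)] show ?thesis
        by (simp add: e(1) edge_iff_adj)
    next
      case (2 u v p)
      then show ?thesis
        using paths path_edges_subset_iff_adj[of "n + 3" "u # p @ [v]"] by auto
    qed
  qed
  ultimately show ?thesis
    unfolding separable_def using F'(1) by blast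
qed

(* Cyclic successors of j up to, and excluding, the next column of S; the arcs of the j in S
   partition the columns. *)
definition arc :: "nat set \<Rightarrow> nat \<Rightarrow> nat list" where
  "arc S j = j # takeWhile (\<lambda>x. x \<notin> S) [Suc j mod 4, (j + 2) mod 4, (j + 3) mod 4]"

text \<open>The walk turns back at the end of the arc, so it starts and ends in the first column of
  \<open>a\<close>, where it can be joined to the two ends of a wrap edge.\<close>

definition detour :: "nat \<Rightarrow> nat list \<Rightarrow> (nat \<times> nat) list" where
  "detour n a = map (Pair (Suc n)) a @ rev (map (Pair (Suc (Suc n))) a)"

text \<open>As the arcs partition the columns, the detours fill both new rows without overlap. The
  proof runs through the possible traces of \<open>S\<close> on the four columns.\<close>

lemma detours_cover:
  assumes "S \<inter> {0..<4} \<noteq> {}"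
  defines "js \<equiv> filter (\<lambda>j. j \<in> S) [0..<4]"
  shows "distinct (concat (map (detour n \<circ> arc S) js))"
    and "set (concat (map (detour n \<circ> arc S) js)) = {Suc n, Suc (Suc n)} \<times> {0..<4}"
    and "j \<in> set js \<Longrightarrow> successively (adj (n + 3)) ((n, j) # detour n (arc S j) @ [(0, 3 - j)])"
proof -
  have upt: "[0..<4] = [0, 1, 2, 3::nat]" by (simp add: upt_rec)
  have all: "{0..<4} = {0, 1, 2, 3::nat}" by auto
  have ne: "0 \<in> S \<or> 1 \<in> S \<or> 2 \<in> S \<or> 3 \<in> S" using assms by (auto simp: all)
  have arcs: "arc S 0 = 0 # takeWhile (\<lambda>x. x \<notin> S) [Suc 0, 2, 3]"
    "arc S (Suc 0) = Suc 0 # takeWhile (\<lambda>x. x \<notin> S) [2, 3, 0]"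
    "arc S 2 = 2 # takeWhile (\<lambda>x. x \<notin> S) [3, 0, Suc 0]"
    "arc S 3 = 3 # takeWhile (\<lambda>x. x \<notin> S) [0, Suc 0, 2]"
    by (simp_all add: arc_def flip: numeral_2_eq_2)
  show "distinct (concat (map (detour n \<circ> arc S) js))"
    using ne unfolding js_def upt
    by (cases "0 \<in> S"; cases "1 \<in> S"; cases "2 \<in> S"; cases "3 \<in> S")
      (simp_all add: arcs detour_def)
  show "set (concat (map (detour n \<circ> arc S) js)) = {Suc n, Suc (Suc n)} \<times> {0..<4}"
    using ne unfolding js_def upt all
    by (cases "0 \<in> S"; cases "1 \<in> S"; cases "2 \<in> S"; cases "3 \<in> S")
      (simp_all add: arcs detour_def, auto)
  show "successively (adj (n + 3)) ((n, j) # detour n (arc S j) @ [(0, 3 - j)])" if "j \<in> set js"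
  proof -
    from that have "j = 0 \<or> j = Suc 0 \<or> j = 2 \<or> j = 3" by (auto simp: js_def)
    then show ?thesis
      by (elim disjE; cases "0 \<in> S"; cases "Suc 0 \<in> S"; cases "2 \<in> S"; cases "3 \<in> S")
        (simp_all add: arcs detour_def adj_def)
  qed
qed

lemma separable_add_rows:
  assumes "0 < n" "separable (klein_grid (Suc n)) A" "A \<subseteq> verts (klein_grid (Suc n))"
  shows "separable (klein_grid (n + 3)) A"
proof -
  from assms(2) obtain F where F: "separates F A" "verts F = verts (klein_grid (Suc n))"
    "edges F \<subseteq> edges (klein_grid (Suc n))" by (auto simp: separable_def)
  have A: "A \<subseteq> verts F" using F(2) assms(3) by simp
  define S where "S = {j. j < 4 \<and> {(n, j), (0, 3 - j)} \<in> edges F}"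
  show ?thesis
  proof (cases "S = {}")
    case False
    then have ne: "S \<inter> {0..<4} \<noteq> {}" by (auto simp: S_def)
    define js where "js = filter (\<lambda>j. j \<in> S) [0..<4]"
    have js: "set js = S" by (auto simp: js_def S_def)
    note cover = detours_cover[OF ne, folded js_def]
    define ts where "ts = map (\<lambda>j. ((n, j), (0::nat, 3 - j), detour n (arc S j))) js"
    show ?thesis
    proof (rule separable_add_rows_via[OF F A])
      show "\<forall>(u, v, p) \<in> set ts. {u, v} \<in> edges F"
        by (auto simp: ts_def js S_def)
      \<comment> \<open>\<open>0 < n\<close> keeps rows \<open>n\<close> and 0 apart; within a
        single row, columns \<open>j\<close> and \<open>3 - j\<close> would give the same
        edge.\<close>
      have "inj_on (\<lambda>j. {(n, j), (0, 3 - j)}) S"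
        using \<open>0 < n\<close> by (auto simp: inj_on_def doubleton_eq_iff)
      then show "distinct (map (\<lambda>(u, v, p). {u, v}) ts)"
        by (simp add: ts_def distinct_map js comp_def) (simp add: js_def)
      show "distinct (concat (map (\<lambda>(u, v, p). p) ts))"
        using cover(1)[of n] by (simp add: ts_def comp_def)
      show "set (concat (map (\<lambda>(u, v, p). p) ts)) = {Suc n, Suc (Suc n)} \<times> {0..<4}"
        using cover(2)[of n] by (simp add: ts_def comp_def)
      show "\<forall>(u, v, p) \<in> set ts. successively (adj (n + 3)) (u # p @ [v])"
        using cover(3) by (auto simp: ts_def)
      show "\<exists>p. ((n, j), (0, 3 - j), p) \<in> set ts" if "j < 4" "{(n, j), (0, 3 - j)} \<in> edges F" for j
        using that by (auto simp: ts_def js S_def)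
    qed
  next
    case True
    \<comment> \<open>Without wrap edges, \<open>F\<close> has at most one vertical edge at
      \<open>(n, 0)\<close>, so valency 2 forces a horizontal one.\<close>
    have "\<exists>b \<in> {1, 3}. {(n, 0), (n, b)} \<in> edges F"
    proof (rule ccontr)
      assume no: "\<not> (\<exists>b \<in> {1, 3}. {(n, 0), (n, b)} \<in> edges F)"
      have "e = {(n, 0), (n - 1, 0)}" if e: "e \<in> edges F" "(n, 0) \<in> e" for e
      proof -
        obtain u v where uv: "e = {u, v}" "adj (Suc n) u v"
          using e F(3) by (auto simp: edges_klein_grid)
        define w where "w = (if u = (n, 0) then v else u)"
        have "e = {(n, 0), w}" "adj (Suc n) (n, 0) w"
          using uv e(2) adj_sym[OF uv(2)] by (auto simp: w_def)
        then obtain i j where ij: "e = {(n, 0), (i, j)}" "adj (Suc n) (n, 0) (i, j)"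
          by (cases w) blast
        then consider "i = n" "j = 1 \<or> j = 3" | "j = 0" "i = n - 1" | "i = 0" "j = 3 - 0"
          using \<open>0 < n\<close> by (auto simp: adj_def less_4_iff)
        then show ?thesis
        proof cases
          case 1
          with no e ij show ?thesis by auto
        next
          case 3
          have "0 \<in> S" using 3 e(1) ij(1) by (simp add: S_def)
          with True show ?thesis by simp
        qed (use ij in simp)
      qed
      then have "{e \<in> edges F. (n, 0) \<in> e} \<subseteq> {{(n, 0), (n - 1, 0)}}" by blast
      then have "valency F (n, 0) \<le> 1"
        unfolding valency_def using card_mono[of "{{(n, 0), (n - 1, 0)}}"] by simp
      moreover have "valency F (n, 0) = 2"
        using separates_regular(2)[OF F(1)] F(2) by (simp add: verts_klein_grid)
      ultimately show False by simp
    qed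
    then obtain b where b: "b = 1 \<or> b = 3" "{(n, 0), (n, b)} \<in> edges F" by blast
    \<comment> \<open>The path zigzags up column 0, down \<open>4 - b\<close>, up 2 and down
      \<open>b\<close>, going round the row away from \<open>b\<close>; here \<open>4 - b\<close> is
      the other neighbour of column 0.\<close>
    define p where "p = [(Suc n, 0), (Suc (Suc n), 0), (Suc (Suc n), 4 - b), (Suc n, 4 - b),
      (Suc n, 2), (Suc (Suc n), 2), (Suc (Suc n), b), (Suc n, b)]"
    have all: "{0..<4} = {0, 1, 2, 3::nat}" by auto
    show ?thesis
    proof (rule separable_add_rows_via[OF F A, of "[((n, 0), (n, b), p)]"])
      show "set (concat (map (\<lambda>(u, v, p). p) [((n, 0), (n, b), p)])) =
          {Suc n, Suc (Suc n)} \<times> {0..<4}"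
        using b(1) unfolding all by (auto simp: p_def)
      show "\<forall>(u, v, p) \<in> set [((n, 0), (n, b), p)]. successively (adj (n + 3)) (u # p @ [v])"
        using b(1) by (auto simp: p_def adj_def)
      show "\<exists>q. ((n, j), (0, 3 - j), q) \<in> set [((n, 0), (n, b), p)]"
        if "j < 4" "{(n, j), (0, 3 - j)} \<in> edges F" for j
        using that True by (auto simp: S_def)
    qed (use b in \<open>auto simp: p_def\<close>)
  qed
qed

section \<open>Small cases\<close>

text \<open>Adjacency keeps the entries inside the grid, so distinctness and the total length
  \<open>4 * m\<close> make the lists span it by counting.\<close>

definition is_factor :: "nat \<Rightarrow> (nat \<times> nat) list list \<Rightarrow> bool" where
  "is_factor m css \<longleftrightarrow> distinct (concat css) \<and> length (concat css) = 4 * m \<and>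
     list_all (\<lambda>c. 3 \<le> length c \<and> successively (adj m) (c @ [hd c])) css"

lemma successively_snoc_neighbour:
  "successively P (xs @ [z]) \<Longrightarrow> x \<in> set xs \<Longrightarrow> \<exists>y. P x y"
  by (induction xs) (auto simp: successively_Cons)

text \<open>There are as many vertices in \<open>as\<close> as disjoint cycles, so if every cycle is
  hit, each is hit exactly once.\<close>

lemma separable_factor:
  assumes "0 < m" and css: "is_factor m css" and as: "distinct as" "length as = length css"
    "set as \<subseteq> verts (klein_grid m)"
    and hit: "list_all (\<lambda>c. list_ex (\<lambda>a. a \<in> set c) as) css"
  shows "separable (klein_grid m) (set as)"
proof -
  have dist: "distinct (concat css)" and len: "length (concat css) = 4 * m"
    and cyc: "\<And>c. c \<in> set css \<Longrightarrow> 3 \<le> length c \<and> successively (adj m) (c @ [hd c])"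
    using css by (auto simp: is_factor_def list_all_iff)
  have edges: "edges (cycle_graph c) \<subseteq> edges (klein_grid m)" if "c \<in> set css" for c
    using cyc[OF that] path_edges_subset_iff_adj[OF \<open>0 < m\<close>, of "c @ [hd c]"]
    by (cases c) (auto simp: edges_cycle_graph)
  define Cs where "Cs = cycle_graph ` set css"
  have nonempty: "[] \<notin> set css" using cyc by fastforce
  have dcss: "distinct css" "\<And>c. c \<in> set css \<Longrightarrow> distinct c"
    and disj: "\<And>c d. c \<in> set css \<Longrightarrow> d \<in> set css \<Longrightarrow> c \<noteq> d \<Longrightarrow> set c \<inter> set d = {}"
    using dist nonempty by (auto simp: distinct_concat_iff)
  have sub: "set (concat css) \<subseteq> verts (klein_grid m)"
  proof
    fix v assume "v \<in> set (concat css)"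
    then obtain c where "c \<in> set css" "v \<in> set c" by auto
    \<comment> \<open>\<open>adj\<close> carries the range bounds, so having a neighbour places
      \<open>v\<close> in the grid.\<close>
    then obtain w where "adj m v w" using cyc successively_snoc_neighbour by metis
    then show "v \<in> verts (klein_grid m)" by (auto simp: adj_def verts_klein_grid)
  qed
  have all: "set (concat css) = verts (klein_grid m)"
  proof (rule card_subset_eq)
    show "card (set (concat css)) = card (verts (klein_grid m))"
      using dist len by (simp add: distinct_card verts_klein_grid del: set_concat)
  qed (use sub in \<open>auto simp: verts_klein_grid\<close>)
  have inj: "inj_on cycle_graph (set css)"
  proof (rule inj_onI, rule ccontr)
    fix c d assume "c \<in> set css" "d \<in> set css" "cycle_graph c = cycle_graph d" "c \<noteq> d"
    then have "set c = {}" using disj by (metis Int_absorb verts_cycle_graph)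
    with \<open>c \<in> set css\<close> nonempty show False by simp
  qed
  have ge1: "1 \<le> card (set as \<inter> set c)" if "c \<in> set css" for c
    using hit that by (auto simp: list_all_iff list_ex_iff Suc_le_eq card_gt_0_iff)
  have "set as = (\<Union>c \<in> set css. set as \<inter> set c)" using all as(3) by auto
  then have "card (set as) = (\<Sum>c \<in> set css. card (set as \<inter> set c))"
    using disj by (subst card_UN_disjoint[symmetric]) auto
  moreover have "card (set as) = (\<Sum>c \<in> set css. 1)"
    using as dcss(1) by (simp add: distinct_card)
  ultimately have eq1: "card (set as \<inter> set c) = 1" if "c \<in> set css" for c
    using ge1 that sum_mono_inv[of "\<lambda>c. 1" "set css" "\<lambda>c. card (set as \<inter> set c)" c] by auto
  define F where "F = \<lparr>verts = verts (klein_grid m), edges = (\<Union>C \<in> Cs. edges C)\<rparr>"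
  have "consists_of_cycles F Cs"
    unfolding consists_of_cycles_def
  proof (intro conjI)
    show "\<forall>C \<in> Cs. is_cycle_graph C"
      using cyc dcss(2) unfolding Cs_def is_cycle_graph_def by blast
    show "\<forall>C \<in> Cs. \<forall>D \<in> Cs. C \<noteq> D \<longrightarrow> verts C \<inter> verts D = {}"
      using disj by (auto simp: Cs_def)
    show "verts F = (\<Union>C \<in> Cs. verts C)"
      using all by (simp add: F_def Cs_def)
  qed (simp add: F_def)
  moreover have "card Cs = card (set as)"
    using inj as dcss(1) by (simp add: Cs_def card_image distinct_card)
  ultimately have "separates F (set as)"
    unfolding separates_def using eq1 by (intro exI[of _ Cs]) (auto simp: Cs_def)
  then show ?thesis
    unfolding separable_def using edges by (intro exI[of _ F]) (auto simp: F_def Cs_def)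
qed

section \<open>Finite verification for grids with few rows\<close>

definition reducible :: "nat \<Rightarrow> nat list \<Rightarrow> bool" where
  "reducible m rs \<longleftrightarrow> 4 < m \<and> list_ex (\<lambda>i. i \<notin> set rs \<and> Suc i mod m \<notin> set rs) [0..<m]"

text \<open>The origin is prepended, so \<open>k\<close> counts only the other vertices. Ordered
  tuples replace sets to make the condition executable; \<open>reducible\<close> ones are left to
  the induction on \<open>m\<close>.\<close>

definition small_case :: "nat \<Rightarrow> nat \<Rightarrow> (nat \<times> nat) list list list \<Rightarrow> bool" where
  "small_case m k L \<longleftrightarrow>
     list_all (\<lambda>css. is_factor m css \<and> length css = Suc k) L \<and>
     list_all (\<lambda>as. (0, 0) \<in> set as \<or> \<not> distinct as \<or> reducible m (0 # map fst as) \<or>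
         list_ex (list_all (\<lambda>c. list_ex (\<lambda>a. a \<in> set c) ((0, 0) # as))) L)
       (List.n_lists k (List.product [0..<m] [0..<4]))"

lemma separable_small_case:
  assumes "0 < m" and small: "small_case m k L"
    and B: "B \<subseteq> verts (klein_grid m)" "card B = Suc k" "(0, 0) \<in> B"
    and no_gap: "\<And>i. 4 < m \<Longrightarrow> i < m \<Longrightarrow> i \<in> fst ` B \<or> Suc i mod m \<in> fst ` B"
  shows "separable (klein_grid m) B"
proof -
  have "finite B" using B(2) card.infinite by fastforce
  then obtain as where as: "set as = B - {(0, 0)}" "distinct as"
    using finite_distinct_list[of "B - {(0, 0)}"] by auto
  then have B_eq: "set ((0, 0) # as) = B" and dist: "distinct ((0, 0) # as)"
    using B(3) by auto
  then have "length as = k" using distinct_card[OF dist] B(2) by simp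
  moreover have "set as \<subseteq> set (List.product [0..<m] [0..<4])"
    using as(1) B(1) by (auto simp: verts_klein_grid)
  ultimately have "as \<in> set (List.n_lists k (List.product [0..<m] [0..<4]))"
    by (simp add: set_n_lists)
  with small as have "reducible m (0 # map fst as) \<or>
      list_ex (list_all (\<lambda>c. list_ex (\<lambda>a. a \<in> set c) ((0, 0) # as))) L"
    unfolding small_case_def list_all_iff by fastforce
  then show ?thesis
  proof
    assume "reducible m (0 # map fst as)"
    moreover have "set (0 # map fst as) = fst ` B" unfolding B_eq[symmetric] by simp
    ultimately obtain i where "4 < m" "i < m" "i \<notin> fst ` B" "Suc i mod m \<notin> fst ` B"
      unfolding reducible_def list_ex_iff by (metis atLeastLessThan_iff set_upt)
    with no_gap show ?thesis by blast
  next
    assume "list_ex (list_all (\<lambda>c. list_ex (\<lambda>a. a \<in> set c) ((0, 0) # as))) L"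
    then obtain css where "css \<in> set L" "list_all (\<lambda>c. list_ex (\<lambda>a. a \<in> set c) ((0, 0) # as)) css"
      by (auto simp: list_ex_iff)
    then show ?thesis
      using separable_factor[OF \<open>0 < m\<close>, of css "(0, 0) # as"] small dist B_eq B(1) \<open>length as = k\<close>
      by (auto simp: small_case_def list_all_iff)
  qed
qed

text \<open>The numbers in the name count rows and cycles. Here and in \<open>factors_4_2\<close>,
  the two cycles through the origin share no other vertex, so any second vertex is separated from it
  by one of the two factors.\<close>

definition factors_3_2 :: "(nat \<times> nat) list list list" where
  "factors_3_2 = [
    [[(0,0), (1,0), (2,0), (2,3)],
     [(0,1), (0,2), (0,3), (1,3), (1,2), (2,2), (2,1), (1,1)]],
    [[(0,0), (0,1), (2,2), (2,1), (1,1), (1,2), (0,2), (0,3)],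
     [(1,0), (1,3), (2,3), (2,0)]]]"

definition factors_4_2 :: "(nat \<times> nat) list list list" where
  "factors_4_2 = [
    [[(0,0), (0,1), (0,2), (0,3)],
     [(1,0), (1,1), (1,2), (2,2), (3,2), (3,1), (2,1), (2,0), (3,0), (3,3), (2,3), (1,3)]],
    [[(0,0), (1,0), (2,0), (2,3), (1,3), (1,2), (2,2), (3,2), (3,3)],
     [(0,1), (0,2), (0,3), (3,0), (3,1), (2,1), (1,1)]]]"

definition factors_3_3 :: "(nat \<times> nat) list list list" where
  "factors_3_3 = [
    [[(0,0), (1,0), (1,3), (2,3)],
     [(0,1), (1,1), (1,2), (2,2)],
     [(0,2), (0,3), (2,0), (2,1)]],
    [[(0,0), (0,1), (0,2), (0,3)],
     [(1,0), (1,3), (2,3), (2,0)],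
     [(1,1), (1,2), (2,2), (2,1)]],
    [[(0,0), (0,1), (2,2), (2,3)],
     [(0,2), (0,3), (1,3), (1,2)],
     [(1,0), (1,1), (2,1), (2,0)]],
    [[(0,0), (0,3), (2,0), (2,3)],
     [(0,1), (0,2), (2,1), (2,2)],
     [(1,0), (1,1), (1,2), (1,3)]],
    [[(0,0), (0,1), (1,1), (1,0)],
     [(0,2), (0,3), (2,0), (2,1)],
     [(1,2), (1,3), (2,3), (2,2)]],
    [[(0,0), (0,1), (0,2), (0,3)],
     [(1,0), (1,1), (1,2), (1,3)],
     [(2,0), (2,1), (2,2), (2,3)]],
    [[(0,0), (0,3), (1,3), (1,0)],
     [(0,1), (0,2), (1,2), (1,1)],
     [(2,0), (2,1), (2,2), (2,3)]],
    [[(0,0), (0,1), (1,1), (1,0)],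
     [(0,2), (1,2), (2,2), (2,1)],
     [(0,3), (1,3), (2,3), (2,0)]]]"

definition factors_4_3 :: "(nat \<times> nat) list list list" where
  "factors_4_3 = [
    [[(0,0), (0,1), (0,2), (0,3)],
     [(1,0), (1,1), (2,1), (2,2), (1,2), (1,3)],
     [(2,0), (2,3), (3,3), (3,2), (3,1), (3,0)]],
    [[(0,0), (0,3), (1,3), (1,0)],
     [(0,1), (0,2), (3,1), (3,2)],
     [(1,1), (1,2), (2,2), (2,3), (3,3), (3,0), (2,0), (2,1)]],
    [[(0,0), (0,1), (3,2), (3,3)],
     [(0,2), (0,3), (1,3), (2,3), (2,2), (1,2)],
     [(1,0), (1,1), (2,1), (3,1), (3,0), (2,0)]],
    [[(0,0), (0,1), (1,1), (1,0)],
     [(0,2), (0,3), (3,0), (2,0), (2,1), (3,1)],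
     [(1,2), (1,3), (2,3), (3,3), (3,2), (2,2)]],
    [[(0,0), (0,3), (3,0), (3,3)],
     [(0,1), (0,2), (1,2), (1,1)],
     [(1,0), (1,3), (2,3), (2,2), (3,2), (3,1), (2,1), (2,0)]],
    [[(0,0), (0,1), (0,2), (0,3)],
     [(1,0), (1,1), (1,2), (1,3), (2,3), (2,0)],
     [(2,1), (2,2), (3,2), (3,3), (3,0), (3,1)]],
    [[(0,0), (1,0), (2,0), (2,3), (3,3)],
     [(0,1), (1,1), (2,1), (2,2), (3,2)],
     [(0,2), (1,2), (1,3), (0,3), (3,0), (3,1)]],
    [[(0,0), (1,0), (1,1), (0,1), (3,2), (3,3)],
     [(0,2), (1,2), (2,2), (2,1), (3,1)],
     [(0,3), (1,3), (2,3), (2,0), (3,0)]]]"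

text \<open>Three vertices including the origin and leaving no two consecutive rows empty have one
  member in rows 1 and 2 and one in rows 3 and 4, so a single factor serves them all.\<close>

definition factors_5_3 :: "(nat \<times> nat) list list list" where
  "factors_5_3 = [
    [[(0,0), (0,1), (0,2), (0,3)],
     [(1,0), (1,3), (1,2), (1,1), (2,1), (2,2), (2,3), (2,0)],
     [(3,0), (3,3), (3,2), (3,1), (4,1), (4,2), (4,3), (4,0)]]]"

text \<open>Three vertices including the origin and leaving no two consecutive rows empty lie in
  rows 0, 2 and 4, which belong to different cycles.\<close>

definition factors_6_3 :: "(nat \<times> nat) list list list" where
  "factors_6_3 = [
    [[(0,0), (0,3), (0,2), (0,1), (1,1), (1,0)],
     [(1,2), (1,3), (2,3), (3,3), (3,0), (2,0), (2,1), (3,1), (3,2), (2,2)],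
     [(4,0), (4,1), (4,2), (4,3), (5,3), (5,2), (5,1), (5,0)]]]"


text \<open>Each search runs over at most \<open>24 ^ 2\<close> tuples.\<close>

lemma small_cases:
  "small_case 3 1 factors_3_2"
  "small_case 4 1 factors_4_2"
  "small_case 3 2 factors_3_3"
  "small_case 4 2 factors_4_3"
  "small_case 5 2 factors_5_3"
  "small_case 6 2 factors_6_3"
  by code_simp+

section \<open>Induction on the number of rows\<close>

lemma separable_remove_gap:
  assumes m: "5 \<le> m" and i: "i < m" and B: "B \<subseteq> verts (klein_grid m)"
    and gap: "i \<notin> fst ` B" "Suc i mod m \<notin> fst ` B"
    and IH: "\<And>A. A \<subseteq> verts (klein_grid (m - 2)) \<Longrightarrow> card A = card B \<Longrightarrow>
      separable (klein_grid (m - 2)) A"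
  shows "separable (klein_grid m) B"
proof -
  \<comment> \<open>Modulo \<open>m\<close> this shift takes row \<open>i\<close> to row
    \<open>m - 2\<close> and its successor to the last row; the extra \<open>m\<close> avoids
    truncation when \<open>i = m - 1\<close>.\<close>
  define r where "r = 2 * m - 2 - i"
  define A where "A = (row_succ m ^^ r) ` B"
  have row: "(a + r) mod m < m - 2" if a: "a < m" "a \<noteq> i" "a \<noteq> Suc i mod m" for a
  proof -
    have "i + 2 \<le> a \<or> a < i" using a i by (cases "Suc i = m") auto
    then consider "i + 2 \<le> a" | "a < i" by blast
    then show ?thesis
    proof cases
      case 1
      then have "a + r = (a - i - 2) + m * 2" using i m by (simp add: r_def)
      then have "(a + r) mod m = a - i - 2" using a by simp
      then show ?thesis using 1 a by simp
    next
      case 2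
      \<comment> \<open>The extreme case \<open>i = m - 1\<close>, \<open>a = 0\<close> is excluded,
        since then \<open>a\<close> is the second row of the gap.\<close>
      have "i - a \<le> m - 2"
        using a i m 2 by (cases "Suc i = m"; cases "a = 0") auto
      then have "a + r = (m - 2 - (i - a)) + m" using 2 i m by (simp add: r_def)
      then have "(a + r) mod m = m - 2 - (i - a)" using m by simp
      then show ?thesis using 2 m by simp
    qed
  qed
  have sub: "A \<subseteq> verts (klein_grid (m - 2))"
  proof
    fix v assume "v \<in> A"
    then obtain w where w: "w \<in> B" "v = (row_succ m ^^ r) w" by (auto simp: A_def)
    have "fst w \<noteq> i" "fst w \<noteq> Suc i mod m"
      using gap imageI[OF w(1), of fst] by metis+
    moreover have "fst w < m" using w(1) B by (auto simp: verts_klein_grid)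
    ultimately have "fst v < m - 2"
      using row row_succ_funpow[of w m r] w B by auto
    moreover have "v \<in> verts (klein_grid m)"
      using row_succ_funpow[of w m r] w B by auto
    ultimately show "v \<in> verts (klein_grid (m - 2))" by (auto simp: verts_klein_grid)
  qed
  moreover have "card A = card B" unfolding A_def using card_row_succ_funpow[OF B] .
  ultimately have sep: "separable (klein_grid (m - 2)) A" by (rule IH)
  \<comment> \<open>With \<open>m - 3\<close> in the role of \<open>n\<close>, the smaller graph has
    \<open>Suc n\<close> rows and the larger one \<open>n + 3\<close>.\<close>
  have eq: "m - 2 = Suc (m - 3)" "m - 3 + 3 = m" "0 < m - 3" using m by auto
  have "separable (klein_grid m) A"
    using separable_add_rows[OF eq(3) sep[unfolded eq(1)] sub[unfolded eq(1)]] unfolding eq(2) .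
  then show ?thesis
    using separable_row_succ_funpow[OF B] m by (simp add: A_def)
qed

text \<open>Every row lies in \<open>R\<close> or is the cyclic predecessor of a row in
  \<open>R\<close>, and predecessors are unique.\<close>

lemma rows_le_of_no_gap:
  assumes "finite R" and no_gap: "\<And>i. i < m \<Longrightarrow> i \<in> R \<or> Suc i mod m \<in> R"
  shows "m \<le> 2 * card R"
proof -
  define P where "P = {i. i < m \<and> Suc i mod m \<in> R}"
  have "inj_on (\<lambda>i. Suc i mod m) P"
    by (auto simp: inj_on_def P_def mod_Suc split: if_splits)
  then have "card P \<le> card R"
    by (rule card_inj_on_le) (auto simp: P_def assms(1))
  moreover have "card {..<m} \<le> card (R \<union> P)"
    using no_gap assms(1) by (intro card_mono) (auto simp: P_def)
  ultimately show ?thesis using card_Un_le[of R P] by simp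
qed

text \<open>The induction ranges over all sets \<open>A\<close>: the shift that deletes a gap may
  move the origin out of the set, so the set is normalised afresh at each \<open>m\<close>.\<close>

lemma separable_klein_grid:
  assumes "k = 2 \<or> k = 3" "3 \<le> m" "A \<subseteq> verts (klein_grid m)" "card A = k"
  shows "separable (klein_grid m) A"
  using assms(2-4)
proof (induction m arbitrary: A rule: less_induct)
  case (less m)
  have "separable (klein_grid m) B"
    if B: "B \<subseteq> verts (klein_grid m)" "card B = k" "(0, 0) \<in> B" for B
  proof (cases "5 \<le> m \<and> (\<exists>i<m. i \<notin> fst ` B \<and> Suc i mod m \<notin> fst ` B)")
    case True
    then show ?thesis
      using separable_remove_gap[of m _ B] B less.IH[of "m - 2"] by auto
  next
    case False
    have "finite B" using B(2) assms(1) card.infinite by fastforce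
    then have "finite (fst ` B)" "card (fst ` B) \<le> k" using B(2) card_image_le by auto
    \<comment> \<open>\<open>B\<close> occupies at most \<open>k\<close> rows, so only
      \<open>m \<le> 4\<close> for \<open>k = 2\<close> and \<open>m \<le> 6\<close> for
      \<open>k = 3\<close> remain.\<close>
    with False rows_le_of_no_gap[of "fst ` B" m] have "m \<le> 4 \<or> m \<le> 2 * k"
      by fastforce
    with assms(1) less.prems(1) consider "k = 2" "m = 3 \<or> m = 4"
      | "k = 3" "m = 3 \<or> m = 4 \<or> m = 5 \<or> m = 6"
      by fastforce
    then obtain L where "small_case m (k - 1) L"
      by cases (use small_cases in \<open>auto simp: numeral_eq_Suc\<close>)
    then show ?thesis
    proof (rule separable_small_case[rotated])
      show "i \<in> fst ` B \<or> Suc i mod m \<in> fst ` B" if "4 < m" "i < m" for i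
        using False that by auto
    qed (use B assms(1) less.prems(1) in auto)
  qed
  then show ?case
    using separable_wlog_origin[of m k A] less.prems assms(1) by auto
qed

theorem theorem4p1:
  fixes m :: nat
  assumes "3 \<le> m"
  shows "spanning_cyclable 2 (twisted_box m tau_refl 4) \<and>
         spanning_cyclable 3 (twisted_box m tau_refl 4)"
  using assms separable_klein_grid by (auto intro!: spanning_cyclableI)

end
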